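(* For every integer $m\ge 2$, the lamplighter group $\mathbb{Z}_m\wr\mathbb{Z}$ has a statistically hyperbolic presentation; that is, there is a finite generating set $S$ of $\mathbb{Z}_m\wr\mathbb{Z}$ such that $E(\mathbb{Z}_m\wr\mathbb{Z},S)$ exists and equals $2$.
   Context: $\mathbb{Z}_m=\mathbb{Z}/m\mathbb{Z}$ and $\wr$ denotes the (restricted) wreath product. For a group $G$ with finite generating set $S$, let $d$ be the word metric on $G$ with respect to $S$, and let $S_n$ be the sphere of radius $n$ about the identity. The sprawl is $$E(G,S):=\lim_{n\to\infty}\frac{1}{|S_n|^2}\sum_{x,y\in S_n}\frac1n\, d(x,y),$$ provided the limit exists; $(G,S)$ is called statistically hyperbolic if $E(G,S)=2$. *)

theory Defs
  imports Complex_Main "HOL-Algebra.Algebra"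
begin

text \<open>
  Restricted wreath product of \<open>A\<close> by \<open>B\<close>: the semidirect product of the direct sum of copies of
  \<open>A\<close> indexed by the elements of \<open>B\<close> with \<open>B\<close>, where \<open>b\<close> acts by left translation of the index,
  \<open>(b \<cdot> f) x = f (b\<inverse> x)\<close>. Functions are extensional, as in \<^const>\<open>sum_group\<close>.
\<close>

definition translate ::
    "('b, 'n) monoid_scheme \<Rightarrow> 'b \<Rightarrow> ('b \<Rightarrow> 'a) \<Rightarrow> 'b \<Rightarrow> 'a"
  where "translate B b f = (\<lambda>x\<in>carrier B. f (inv\<^bsub>B\<^esub> b \<otimes>\<^bsub>B\<^esub> x))"

definition wreath_product ::
    "('a, 'm) monoid_scheme \<Rightarrow> ('b, 'n) monoid_scheme \<Rightarrow> (('b \<Rightarrow> 'a) \<times> 'b) monoid"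
  where "wreath_product A B =
    (let N = sum_group (carrier B) (\<lambda>_. A) in
      \<lparr>carrier = carrier N \<times> carrier B,
       monoid.mult = (\<lambda>(f, b) (g, c). (f \<otimes>\<^bsub>N\<^esub> translate B b g, b \<otimes>\<^bsub>B\<^esub> c)),
       one = (\<one>\<^bsub>N\<^esub>, \<one>\<^bsub>B\<^esub>)\<rparr>)"

lemma translate_closed:
  assumes "group A" "group B" "b \<in> carrier B"
    and f: "f \<in> carrier (sum_group (carrier B) (\<lambda>_. A))"
  shows "translate B b f \<in> carrier (sum_group (carrier B) (\<lambda>_. A))"
proof -
  interpret B: group B by fact
  have "f \<in> (\<Pi>\<^sub>E i\<in>carrier B. carrier A)"
    and fin: "finite {i \<in> carrier B. f i \<noteq> \<one>\<^bsub>A\<^esub>}"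
    using f by (auto simp: carrier_sum_group assms(1))
  moreover have "{i \<in> carrier B. translate B b f i \<noteq> \<one>\<^bsub>A\<^esub>}
      \<subseteq> (\<lambda>x. b \<otimes>\<^bsub>B\<^esub> x) ` {i \<in> carrier B. f i \<noteq> \<one>\<^bsub>A\<^esub>}"
  proof
    fix i assume i: "i \<in> {i \<in> carrier B. translate B b f i \<noteq> \<one>\<^bsub>A\<^esub>}"
    then have "i = b \<otimes>\<^bsub>B\<^esub> (inv\<^bsub>B\<^esub> b \<otimes>\<^bsub>B\<^esub> i)"
      using assms(3) by (simp add: B.m_assoc[symmetric])
    with i show "i \<in> (\<lambda>x. b \<otimes>\<^bsub>B\<^esub> x) ` {i \<in> carrier B. f i \<noteq> \<one>\<^bsub>A\<^esub>}"
      using assms(3) by (auto simp: translate_def)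
  qed
  then have "finite {i \<in> carrier B. translate B b f i \<noteq> \<one>\<^bsub>A\<^esub>}"
    using fin finite_subset by blast
  ultimately show ?thesis
    using assms(3) by (auto simp: carrier_sum_group assms(1) translate_def PiE_iff)
qed

lemma group_wreath_product:
  assumes "group A" "group B"
  shows "group (wreath_product A B)"
proof -
  interpret A: group A by fact
  interpret B: group B by fact
  let ?N = "sum_group (carrier B) (\<lambda>_. A)"
  interpret N: group ?N by (simp add: assms)
  have t_mult: "translate B b (f \<otimes>\<^bsub>?N\<^esub> g) = translate B b f \<otimes>\<^bsub>?N\<^esub> translate B b g"
    if "b \<in> carrier B" for b f g
    using that by (auto simp: translate_def)
  have t_comp: "translate B b (translate B c f) = translate B (b \<otimes>\<^bsub>B\<^esub> c) f"
    if "b \<in> carrier B" "c \<in> carrier B" for b c f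
    using that by (auto simp: translate_def B.inv_mult_group B.m_assoc)
  have t_one: "translate B \<one>\<^bsub>B\<^esub> f = f" if "f \<in> carrier ?N" for f
    using that by (auto simp: translate_def carrier_sum_group assms PiE_iff extensional_def)
  have t_N_one: "translate B b \<one>\<^bsub>?N\<^esub> = \<one>\<^bsub>?N\<^esub>" if "b \<in> carrier B" for b
    using that by (auto simp: translate_def)
  note closed = translate_closed[OF assms]
  note [simp del] = mult_sum_group one_sum_group
  show ?thesis
  proof (rule groupI)
    show "\<exists>y\<in>carrier (wreath_product A B).
        y \<otimes>\<^bsub>wreath_product A B\<^esub> x = \<one>\<^bsub>wreath_product A B\<^esub>"
      if x: "x \<in> carrier (wreath_product A B)" for x
    proof -
      obtain f b where fb: "x = (f, b)" "f \<in> carrier ?N" "b \<in> carrier B"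
        using x by (auto simp: wreath_product_def Let_def)
      have "(translate B (inv\<^bsub>B\<^esub> b) (inv\<^bsub>?N\<^esub> f), inv\<^bsub>B\<^esub> b) \<in> carrier (wreath_product A B)"
        using fb N.inv_closed closed by (simp add: wreath_product_def Let_def)
      moreover have "(translate B (inv\<^bsub>B\<^esub> b) (inv\<^bsub>?N\<^esub> f), inv\<^bsub>B\<^esub> b)
          \<otimes>\<^bsub>wreath_product A B\<^esub> x = \<one>\<^bsub>wreath_product A B\<^esub>"
        using fb N.l_inv[of f]
        by (simp add: wreath_product_def Let_def t_mult[symmetric] t_N_one del: inv_sum_group N.l_inv)
      ultimately show ?thesis by blast
    qed
  qed (auto simp: wreath_product_def Let_def closed t_mult t_comp t_one N.m_assoc B.m_assoc)
qed

abbreviation lamplighter_group :: "nat \<Rightarrow> ((int \<Rightarrow> int) \<times> int) monoid"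
  where "lamplighter_group m \<equiv> wreath_product (integer_mod_group m) integer_group"

definition finite_generating_set :: "('a, 'b) monoid_scheme \<Rightarrow> 'a set \<Rightarrow> bool"
  where "finite_generating_set G S \<longleftrightarrow>
    finite S \<and> S \<subseteq> carrier G \<and> generate G S = carrier G"

text \<open>
  Word length with respect to \<open>S\<close>: words are in the letters of \<open>S\<close> and their inverses; \<open>S\<close> itself
  need not be symmetric. The value is only meaningful for elements of \<^term>\<open>generate G S\<close>.
\<close>

definition word_length :: "('a, 'b) monoid_scheme \<Rightarrow> 'a set \<Rightarrow> 'a \<Rightarrow> nat"
  where "word_length G S g = (LEAST n. \<exists>ws. length ws = n \<and>
    set ws \<subseteq> S \<union> (\<lambda>s. inv\<^bsub>G\<^esub> s) ` S \<and> foldr (\<otimes>\<^bsub>G\<^esub>) ws \<one>\<^bsub>G\<^esub> = g)"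

definition word_dist :: "('a, 'b) monoid_scheme \<Rightarrow> 'a set \<Rightarrow> 'a \<Rightarrow> 'a \<Rightarrow> nat"
  where "word_dist G S x y = word_length G S (inv\<^bsub>G\<^esub> x \<otimes>\<^bsub>G\<^esub> y)"

definition word_sphere :: "('a, 'b) monoid_scheme \<Rightarrow> 'a set \<Rightarrow> nat \<Rightarrow> 'a set"
  where "word_sphere G S n = {x \<in> carrier G. word_dist G S \<one>\<^bsub>G\<^esub> x = n}"

definition mean_sphere_dist :: "('a, 'b) monoid_scheme \<Rightarrow> 'a set \<Rightarrow> nat \<Rightarrow> real"
  where "mean_sphere_dist G S n =
    1 / (real (card (word_sphere G S n)))\<^sup>2 *
      (\<Sum>(x, y) \<in> word_sphere G S n \<times> word_sphere G S n. 1 / real n * real (word_dist G S x y))"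

text \<open>
  \<open>sprawl\<close> is meaningful only if the defining sequence converges, so convergence is a separate
  conjunct of \<open>statistically_hyperbolic\<close>.
\<close>

definition sprawl :: "('a, 'b) monoid_scheme \<Rightarrow> 'a set \<Rightarrow> real"
  where "sprawl G S = lim (mean_sphere_dist G S)"

definition statistically_hyperbolic :: "('a, 'b) monoid_scheme \<Rightarrow> 'a set \<Rightarrow> bool"
  where "statistically_hyperbolic G S \<longleftrightarrow>
    convergent (mean_sphere_dist G S) \<and> sprawl G S = 2"

end

theory Submission
  imports Defs "HOL-Real_Asymp.Real_Asymp"
begin

text \<open>
  Generate by the elements "set the lamp at the cursor, then step right". A word of length \<open>n\<close>
  ending at cursor position \<open>b\<close> only touches lamps in an interval \<open>[L, R)\<close> with
  \<open>2 (R - L) - |b| \<le> n\<close>, so a point of \<open>S\<^sub>n\<close> with \<open>|b| \<le> n - 2k\<close> involves at most \<open>n - k\<close>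
  lamps. There are \<open>O(n\<^sup>3 m^(n - k))\<close> such points, while \<open>|S\<^sub>n| \<ge> m^n\<close>. Hence for \<open>k = \<surd>n\<close>
  almost all points have their cursor within \<open>2k\<close> of \<open>n\<close> or \<open>-n\<close>. Two points on opposite sides are
  then almost \<open>2n\<close> apart. Two points on the same side almost surely differ in one of the \<open>k\<close>
  lamps nearest the origin, and a path between them must return there, so their distance is
  at least \<open>2n - 6k\<close>.
\<close>

section \<open>Word length in a group\<close>

context group
begin

lemma foldr_mult_closed:
  assumes "set ws \<subseteq> carrier G"
  shows "foldr (\<otimes>) ws \<one> \<in> carrier G"
  using assms by (induction ws) auto

lemma foldr_mult_append:
  assumes "set us \<subseteq> carrier G" "set vs \<subseteq> carrier G"
  shows "foldr (\<otimes>) (us @ vs) \<one> = foldr (\<otimes>) us \<one> \<otimes> foldr (\<otimes>) vs \<one>"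
  using assms by (induction us) (auto simp: foldr_mult_closed m_assoc)

lemma foldr_mult_rev_inv:
  assumes "set ws \<subseteq> carrier G"
  shows "foldr (\<otimes>) (rev (map (\<lambda>w. inv w) ws)) \<one> = inv (foldr (\<otimes>) ws \<one>)"
  using assms
proof (induction ws)
  case (Cons w ws)
  moreover have "(\<lambda>w. inv w) ` set ws \<subseteq> carrier G"
    using Cons.prems by auto
  ultimately show ?case
    by (simp add: foldr_mult_append foldr_mult_closed inv_mult_group del: foldr_append)
qed simp

lemma letters_closed:
  assumes "S \<subseteq> carrier G"
  shows "S \<union> (\<lambda>s. inv s) ` S \<subseteq> carrier G"
  using assms by auto

text \<open>\<open>word_length\<close> is a \<open>LEAST\<close>, so it carries information only
  once some word spells the element; membership in the generated subgroup supplies one.\<close>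

lemma generate_imp_word:
  assumes "S \<subseteq> carrier G" "g \<in> generate G S"
  shows "\<exists>ws. set ws \<subseteq> S \<union> (\<lambda>s. inv s) ` S \<and> foldr (\<otimes>) ws \<one> = g"
  using assms(2)
proof induction
  case one
  show ?case by (rule exI[of _ "[]"]) simp
next
  case (incl h)
  with assms(1) show ?case by (intro exI[of _ "[h]"]) auto
next
  case (inv h)
  with assms(1) show ?case by (intro exI[of _ "[inv h]"]) auto
next
  case (eng h1 h2)
  then obtain us vs where us: "set us \<subseteq> S \<union> (\<lambda>s. inv s) ` S" "foldr (\<otimes>) us \<one> = h1"
    and vs: "set vs \<subseteq> S \<union> (\<lambda>s. inv s) ` S" "foldr (\<otimes>) vs \<one> = h2"
    by blast
  have closed: "S \<union> (\<lambda>s. inv s) ` S \<subseteq> carrier G"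
    using letters_closed[OF assms(1)] .
  from us vs show ?case
    using foldr_mult_append[OF subset_trans[OF us(1) closed] subset_trans[OF vs(1) closed]]
    by (intro exI[of _ "us @ vs"]) (simp del: foldr_append)
qed

lemma word_length_le:
  assumes "set ws \<subseteq> S \<union> (\<lambda>s. inv s) ` S" "foldr (\<otimes>) ws \<one> = g"
  shows "word_length G S g \<le> length ws"
  unfolding word_length_def using assms by (intro Least_le) auto

lemma word_length_attained:
  assumes "finite_generating_set G S" "g \<in> carrier G"
  obtains ws where "length ws = word_length G S g" "set ws \<subseteq> S \<union> (\<lambda>s. inv s) ` S"
    "foldr (\<otimes>) ws \<one> = g"
proof -
  have "\<exists>n ws. length ws = n \<and> set ws \<subseteq> S \<union> (\<lambda>s. inv s) ` S \<and> foldr (\<otimes>) ws \<one> = g"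
    using generate_imp_word[of S g] assms by (auto simp: finite_generating_set_def)
  from LeastI_ex[OF this] that show ?thesis
    unfolding word_length_def by blast
qed

lemma word_dist_one_left:
  assumes "x \<in> carrier G"
  shows "word_dist G S \<one> x = word_length G S x"
  using assms by (simp add: word_dist_def)

text \<open>The triangle inequality through the identity: a shortest word for \<open>x\<close>,
  reversed and inverted, followed by a shortest word for \<open>y\<close>. On the sphere of radius
  \<open>n\<close> it bounds distances by \<open>2 * n\<close>.\<close>

lemma word_dist_le_sum:
  assumes "finite_generating_set G S" "x \<in> carrier G" "y \<in> carrier G"
  shows "word_dist G S x y \<le> word_length G S x + word_length G S y"
proof -
  obtain us where us: "length us = word_length G S x" "set us \<subseteq> S \<union> (\<lambda>s. inv s) ` S"
      "foldr (\<otimes>) us \<one> = x"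
    using word_length_attained assms by blast
  obtain vs where vs: "length vs = word_length G S y" "set vs \<subseteq> S \<union> (\<lambda>s. inv s) ` S"
      "foldr (\<otimes>) vs \<one> = y"
    using word_length_attained assms by blast
  have S: "S \<subseteq> carrier G"
    using assms(1) by (simp add: finite_generating_set_def)
  note closed = letters_closed[OF S]
  let ?us = "rev (map (\<lambda>w. inv w) us)"
  have letters: "set ?us \<subseteq> S \<union> (\<lambda>s. inv s) ` S"
    using us(2) S by (force simp: subset_iff)
  have "foldr (\<otimes>) (?us @ vs) \<one> = inv x \<otimes> y"
    using foldr_mult_append[OF subset_trans[OF letters closed] subset_trans[OF vs(2) closed]]
      foldr_mult_rev_inv[OF subset_trans[OF us(2) closed]] us(3) vs(3)
    by (simp del: foldr_append)
  then have "word_length G S (inv x \<otimes> y) \<le> length (?us @ vs)"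
    using letters vs(2) by (intro word_length_le) auto
  then show ?thesis
    by (simp add: word_dist_def us(1) vs(1))
qed

end

section \<open>The lamplighter group\<close>

lemma group_lamplighter [simp]: "group (lamplighter_group m)"
  by (simp add: group_wreath_product)

text \<open>Indices range over all integers, so extensionality is vacuous. For \<open>m = 0\<close>
  the lamp group would be the integers instead of residues, hence \<open>m > 0\<close>.\<close>

lemma carrier_lamplighter:
  assumes "m > 0"
  shows "carrier (lamplighter_group m) =
    {f. range f \<subseteq> {0..<int m} \<and> finite {i. f i \<noteq> 0}} \<times> UNIV"
  using assms
  by (auto simp: wreath_product_def carrier_sum_group carrier_integer_mod_group PiE_iff image_subset_iff)

lemma mult_lamplighter:
  assumes "m > 0"
  shows "(f, b) \<otimes>\<^bsub>lamplighter_group m\<^esub> (g, c) =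
    (\<lambda>i. (f i + g (i - b)) mod int m, b + c)"
  using assms
  by (auto simp: wreath_product_def translate_def integer_mod_group_def fun_eq_iff)

lemma one_lamplighter: "\<one>\<^bsub>lamplighter_group m\<^esub> = (\<lambda>_. 0, 0)"
  by (auto simp: wreath_product_def fun_eq_iff)

text \<open>
  \<open>move i\<close> adds \<open>i\<close> to the lamp at the cursor and then steps right, so a lamp sits on the edge
  between two neighbouring cursor positions and can be reset whenever that edge is crossed.
\<close>

definition move :: "int \<Rightarrow> (int \<Rightarrow> int) \<times> int"
  where "move i = (\<lambda>p. if p = 0 then i else 0, 1)"

definition moves :: "nat \<Rightarrow> ((int \<Rightarrow> int) \<times> int) set"
  where "moves m = move ` {0..<int m}"

lemma move_closed:
  assumes "i \<in> {0..<int m}"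
  shows "move i \<in> carrier (lamplighter_group m)"
proof -
  have "{p. (if p = 0 then i else 0) \<noteq> 0} \<subseteq> {0::int}"
    by auto
  then have "finite {p::int. (if p = 0 then i else 0) \<noteq> 0}"
    using finite_subset by blast
  with assms show ?thesis
    by (auto simp: carrier_lamplighter move_def)
qed

lemma moves_subset: "moves m \<subseteq> carrier (lamplighter_group m)"
  using move_closed by (auto simp: moves_def)

lemma inv_move:
  assumes "i \<in> {0..<int m}"
  obtains u where "inv\<^bsub>lamplighter_group m\<^esub> (move i) = (u, -1)" "\<And>p. p \<noteq> -1 \<Longrightarrow> u p = 0"
proof -
  interpret group "lamplighter_group m" by simp
  have m: "m > 0" using assms by auto
  obtain u e where ue: "inv\<^bsub>lamplighter_group m\<^esub> (move i) = (u, e)"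
    by fastforce
  have closed: "(u, e) \<in> carrier (lamplighter_group m)"
    using ue inv_closed move_closed assms by metis
  have "move i \<otimes>\<^bsub>lamplighter_group m\<^esub> (u, e) = \<one>\<^bsub>lamplighter_group m\<^esub>"
    using r_inv[OF move_closed[OF assms]] ue by simp
  then have eq: "(\<lambda>p. ((if p = 0 then i else 0) + u (p - 1)) mod int m) = (\<lambda>_. 0)" and e: "e = -1"
    by (auto simp: move_def mult_lamplighter[OF m] one_lamplighter)
  \<comment> \<open>The product determines \<open>u\<close> only modulo \<open>m\<close>;
    representatives in \<open>{0..<int m}\<close> turn divisibility into equality with 0.\<close>
  have "u p = 0" if "p \<noteq> -1" for p
  proof -
    have "u p \<in> {0..<int m}"
      using closed by (auto simp: carrier_lamplighter[OF m] image_subset_iff)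
    with fun_cong[OF eq, of "p + 1"] that show ?thesis
      by auto
  qed
  with ue e show ?thesis using that by blast
qed

text \<open>The cursor of a word stays between \<open>L\<close> and \<open>R\<close>; the shortest tour visits both ends.\<close>

lemma word_extent:
  assumes "m > 0"
    and "set ws \<subseteq> moves m \<union> (\<lambda>s. inv\<^bsub>lamplighter_group m\<^esub> s) ` moves m"
    and "foldr (\<otimes>\<^bsub>lamplighter_group m\<^esub>) ws \<one>\<^bsub>lamplighter_group m\<^esub> = (f, b)"
  shows "\<exists>L R. L \<le> 0 \<and> 0 \<le> R \<and> L \<le> b \<and> b \<le> R \<and> {p. f p \<noteq> 0} \<subseteq> {L..<R} \<and>
    2 * (R - L) - \<bar>b\<bar> \<le> int (length ws)"
  using assms(2,3)
proof (induction ws arbitrary: f b)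
  case Nil
  then show ?case
    by (intro exI[of _ 0]) (auto simp: one_lamplighter)
next
  case (Cons w ws)
  obtain g c where gc:
    "foldr (\<otimes>\<^bsub>lamplighter_group m\<^esub>) ws \<one>\<^bsub>lamplighter_group m\<^esub> = (g, c)"
    by fastforce
  obtain L R where LR: "L \<le> 0" "0 \<le> R" "L \<le> c" "c \<le> R" "{p. g p \<noteq> 0} \<subseteq> {L..<R}"
    "2 * (R - L) - \<bar>c\<bar> \<le> int (length ws)"
    using Cons.IH[OF _ gc] Cons.prems(1) by auto
  have g0: "g p = 0" if "p < L \<or> R \<le> p" for p
    using LR(5) that by force
  have prod: "w \<otimes>\<^bsub>lamplighter_group m\<^esub> (g, c) = (f, b)"
    using Cons.prems(2) gc by simp
  from Cons.prems(1) consider i where "i \<in> {0..<int m}" "w = move i"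
    | i where "i \<in> {0..<int m}" "w = inv\<^bsub>lamplighter_group m\<^esub> (move i)"
    by (auto simp: moves_def)
  then show ?case
  proof cases
    case 1
    then have f: "f = (\<lambda>p. ((if p = 0 then i else 0) + g (p - 1)) mod int m)" and b: "b = 1 + c"
      using prod by (auto simp: move_def mult_lamplighter[OF assms(1)])
    \<comment> \<open>Prepending a letter translates the rest of the tour by one, and the interval
      is stretched to contain the new origin.\<close>
    have "f p = 0" if "p < min 0 (L + 1) \<or> R + 1 \<le> p" for p
      using that LR g0[of "p - 1"] by (auto simp: f)
    then have "{p. f p \<noteq> 0} \<subseteq> {min 0 (L + 1)..<R + 1}"
      by (auto simp: not_le[symmetric])
    \<comment> \<open>If \<open>L = 0\<close>, the interval grows by one, but \<open>c\<close> is
      nonnegative, so the modulus of the cursor grows too. Otherwise the interval keeps its length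
      and the modulus drops by at most one.\<close>
    moreover have "2 * (R + 1 - (min 0 (L + 1))) - \<bar>b\<bar> \<le> 2 * (R - L) - \<bar>c\<bar> + 1"
      using LR(1-4) by (cases "L = 0") (simp_all add: b)
    then have "2 * (R + 1 - (min 0 (L + 1))) - \<bar>b\<bar> \<le> int (length (w # ws))"
      using LR(6) by simp
    moreover have "min 0 (L + 1) \<le> 0" "0 \<le> R + 1" "min 0 (L + 1) \<le> b" "b \<le> R + 1"
      using LR(1-4) by (simp_all add: b)
    ultimately show ?thesis by blast
  next
    case 2
    obtain u where u: "w = (u, -1)" "\<And>p. p \<noteq> -1 \<Longrightarrow> u p = 0"
      using inv_move[OF 2(1)] 2(2) by metis
    then have f: "f = (\<lambda>p. (u p + g (p + 1)) mod int m)" and b: "b = c - 1"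
      using prod by (auto simp: mult_lamplighter[OF assms(1)])
    have "f p = 0" if "p < L - 1 \<or> max 0 (R - 1) \<le> p" for p
      using that LR g0[of "p + 1"] u(2)[of p] by (auto simp: f)
    then have "{p. f p \<noteq> 0} \<subseteq> {L - 1..<max 0 (R - 1)}"
      by (auto simp: not_le[symmetric])
    \<comment> \<open>The mirror image: the interval grows only if \<open>R = 0\<close>, and then
      \<open>c\<close> is nonpositive and the cursor moves further away from 0.\<close>
    moreover have "2 * (max 0 (R - 1) - (L - 1)) - \<bar>b\<bar> \<le> 2 * (R - L) - \<bar>c\<bar> + 1"
      using LR(1-4) by (cases "R = 0") (simp_all add: b)
    then have "2 * (max 0 (R - 1) - (L - 1)) - \<bar>b\<bar> \<le> int (length (w # ws))"
      using LR(6) by simp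
    moreover have "L - 1 \<le> 0" "0 \<le> max 0 (R - 1)" "L - 1 \<le> b" "b \<le> max 0 (R - 1)"
      using LR(1-4) by (simp_all add: b)
    ultimately show ?thesis by blast
  qed
qed

text \<open>A single pass to the right sets each lamp as it is crossed. This yields both generation
  and the \<open>m ^ n\<close> points on the sphere.\<close>

lemma rightward_word:
  assumes "m > 0" "range f \<subseteq> {0..<int m}" "{p. f p \<noteq> 0} \<subseteq> {0..<int n}"
  shows "\<exists>ws. length ws = n \<and> set ws \<subseteq> moves m \<and>
    foldr (\<otimes>\<^bsub>lamplighter_group m\<^esub>) ws \<one>\<^bsub>lamplighter_group m\<^esub> = (f, int n)"
  using assms(2,3)
proof (induction n arbitrary: f)
  case 0
  then have "f = (\<lambda>_. 0)" by auto
  then show ?case by (simp add: one_lamplighter)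
next
  case (Suc n)
  \<comment> \<open>The pattern left to write after the first step, seen from position 1; index -1
    is the old lamp 0, which the first letter sets.\<close>
  define g where "g = (\<lambda>p. if p = -1 then 0 else f (p + 1))"
  have f0: "f p = 0" if "p < 0 \<or> int (Suc n) \<le> p" for p
    using Suc.prems(2) that by force
  have "range g \<subseteq> {0..<int m}"
    using Suc.prems(1) assms(1) by (auto simp: g_def image_subset_iff)
  moreover have "g p = 0" if "p < 0 \<or> int n \<le> p" for p
    using f0[of "p + 1"] that by (auto simp: g_def)
  then have "{p. g p \<noteq> 0} \<subseteq> {0..<int n}"
    by (auto simp: not_le[symmetric])
  ultimately obtain ws where ws: "length ws = n" "set ws \<subseteq> moves m"
    "foldr (\<otimes>\<^bsub>lamplighter_group m\<^esub>) ws \<one>\<^bsub>lamplighter_group m\<^esub> = (g, int n)"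
    using Suc.IH by blast
  have mod: "f p mod int m = f p" for p
    using Suc.prems(1) by (intro mod_pos_pos_trivial) (auto simp: image_subset_iff)
  have "move (f 0) \<otimes>\<^bsub>lamplighter_group m\<^esub> (g, int n) = (f, int (Suc n))"
    by (auto simp: move_def mult_lamplighter[OF assms(1)] g_def mod fun_eq_iff)
  moreover have "move (f 0) \<in> moves m"
    using Suc.prems(1) by (auto simp: moves_def image_subset_iff)
  ultimately show ?case
    using ws by (intro exI[of _ "move (f 0) # ws"]) auto
qed

text \<open>Pure shifts are rightward words or inverses of such, and a shift brings any finite
  pattern into the range of a single rightward pass.\<close>

lemma finite_generating_set_moves:
  assumes m: "m > 0"
  shows "finite_generating_set (lamplighter_group m) (moves m)"
proof -
  let ?G = "lamplighter_group m"
  interpret group ?G by simp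
  interpret H: subgroup "generate ?G (moves m)" ?G
    by (rule generate_is_subgroup[OF moves_subset])
  have word: "foldr (\<otimes>\<^bsub>?G\<^esub>) ws \<one>\<^bsub>?G\<^esub> \<in> generate ?G (moves m)" if "set ws \<subseteq> moves m" for ws
    using that by (induction ws) (auto intro: generate.incl)
  have right: "(f, int n) \<in> generate ?G (moves m)"
    if "range f \<subseteq> {0..<int m}" "{p. f p \<noteq> 0} \<subseteq> {0..<int n}" for f n
    using rightward_word[OF m that] word by metis
  have shift: "(\<lambda>_. 0, k) \<in> generate ?G (moves m)" for k
  proof (cases "k \<ge> 0")
    case True
    with right[of "\<lambda>_. 0" "nat k"] m show ?thesis by auto
  next
    case False
    then have h: "(\<lambda>_. 0, - k) \<in> generate ?G (moves m)"
      using right[of "\<lambda>_. 0" "nat (- k)"] m by auto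
    have "(\<lambda>_. 0, k) \<in> carrier ?G"
      using m by (auto simp: carrier_lamplighter)
    moreover have "(\<lambda>_. 0, k) \<otimes>\<^bsub>?G\<^esub> (\<lambda>_. 0, - k) = \<one>\<^bsub>?G\<^esub>"
      using m by (simp add: mult_lamplighter one_lamplighter)
    ultimately have "inv\<^bsub>?G\<^esub> (\<lambda>_. 0, - k) = (\<lambda>_. 0, k)"
      using H.mem_carrier[OF h] by (simp add: inv_equality)
    then show ?thesis
      using H.m_inv_closed[OF h] by simp
  qed
  have "(f, b) \<in> generate ?G (moves m)" if "(f, b) \<in> carrier ?G" for f b
  proof -
    have f: "range f \<subseteq> {0..<int m}" "finite {p. f p \<noteq> 0}"
      using that by (auto simp: carrier_lamplighter[OF m])
    from f(2) have "finite ((\<lambda>p. nat \<bar>p\<bar>) ` {p. f p \<noteq> 0})"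
      by simp
    then obtain N where N: "\<And>p. f p \<noteq> 0 \<Longrightarrow> nat \<bar>p\<bar> < N"
      using finite_nat_set_iff_bounded by auto
    define g where "g = (\<lambda>p. f (p - int N))"
    have "{p. g p \<noteq> 0} \<subseteq> {0..<int (2 * N)}"
    proof
      fix p assume "p \<in> {p. g p \<noteq> 0}"
      then have "nat \<bar>p - int N\<bar> < N" using N by (simp add: g_def)
      then show "p \<in> {0..<int (2 * N)}" by auto
    qed
    moreover have "range g \<subseteq> {0..<int m}"
      using f(1) by (auto simp: g_def)
    ultimately have "(g, int (2 * N)) \<in> generate ?G (moves m)"
      by (intro right)
    \<comment> \<open>Go left by \<open>N\<close>, write the pattern over an interval of length
      \<open>2 * N\<close>, then correct the cursor from \<open>N\<close> to
      \<open>b\<close>.\<close>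
    then have "(\<lambda>_. 0, - int N) \<otimes>\<^bsub>?G\<^esub> (g, int (2 * N)) \<otimes>\<^bsub>?G\<^esub> (\<lambda>_. 0, b - int N)
        \<in> generate ?G (moves m)"
      by (intro H.m_closed shift)
    moreover have "f p mod int m = f p" for p
      using f(1) by (intro mod_pos_pos_trivial) (auto simp: image_subset_iff)
    ultimately show ?thesis
      using m by (simp add: mult_lamplighter g_def)
  qed
  then have "carrier ?G \<subseteq> generate ?G (moves m)"
    by auto
  then show ?thesis
    using moves_subset H.subset by (auto simp: finite_generating_set_def moves_def)
qed

section \<open>Lower bounds on word length and distance\<close>

lemma word_length_extent:
  assumes "m > 0" "(f, b) \<in> carrier (lamplighter_group m)"
  obtains L R where "L \<le> 0" "0 \<le> R" "L \<le> b" "b \<le> R" "{p. f p \<noteq> 0} \<subseteq> {L..<R}"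
    "2 * (R - L) - \<bar>b\<bar> \<le> int (word_length (lamplighter_group m) (moves m) (f, b))"
proof -
  interpret group "lamplighter_group m" by simp
  obtain ws where "length ws = word_length (lamplighter_group m) (moves m) (f, b)"
    "set ws \<subseteq> moves m \<union> (\<lambda>s. inv\<^bsub>lamplighter_group m\<^esub> s) ` moves m"
    "foldr (\<otimes>\<^bsub>lamplighter_group m\<^esub>) ws \<one>\<^bsub>lamplighter_group m\<^esub> = (f, b)"
    using word_length_attained[OF finite_generating_set_moves[OF assms(1)] assms(2)] .
  with word_extent[OF assms(1) this(2,3)] that show ?thesis by auto
qed

text \<open>One pass gives the upper bound. Conversely the tour covers both 0 and \<open>n\<close>,
  so \<open>R - L\<close> is at least \<open>n\<close> and the extent bound is at least
  \<open>2 * n - n\<close>.\<close>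

lemma word_length_rightward:
  assumes "m > 0" "range f \<subseteq> {0..<int m}" "{p. f p \<noteq> 0} \<subseteq> {0..<int n}"
  shows "word_length (lamplighter_group m) (moves m) (f, int n) = n"
proof (rule antisym)
  interpret group "lamplighter_group m" by simp
  obtain ws where ws: "length ws = n" "set ws \<subseteq> moves m"
    "foldr (\<otimes>\<^bsub>lamplighter_group m\<^esub>) ws \<one>\<^bsub>lamplighter_group m\<^esub> = (f, int n)"
    using rightward_word[OF assms] by blast
  have "word_length (lamplighter_group m) (moves m) (f, int n) \<le> length ws"
    using ws by (intro word_length_le) auto
  with ws(1) show "word_length (lamplighter_group m) (moves m) (f, int n) \<le> n"
    by simp
  have "(f, int n) \<in> carrier (lamplighter_group m)"
    using assms by (auto simp: carrier_lamplighter intro: finite_subset)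
  from word_length_extent[OF assms(1) this]
  show "n \<le> word_length (lamplighter_group m) (moves m) (f, int n)"
    by (smt (verit) of_nat_0_le_iff of_nat_le_iff)
qed

text \<open>A path between the two points takes the cursor from \<open>b\<close> to \<open>c\<close>
  and must visit each lamp \<open>p\<close> where the patterns differ. The two lamp bounds are sharp
  for \<open>p\<close> to the left and to the right of both cursors, up to the width of a
  lamp.\<close>

lemma word_dist_ge_cursor:
  assumes "m > 0" "(f, b) \<in> carrier (lamplighter_group m)" "(g, c) \<in> carrier (lamplighter_group m)"
  shows "\<bar>c - b\<bar> \<le> int (word_dist (lamplighter_group m) (moves m) (f, b) (g, c))"
    and "f p \<noteq> g p \<Longrightarrow> b + c - 2 * p \<le> int (word_dist (lamplighter_group m) (moves m) (f, b) (g, c))"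
    and "f p \<noteq> g p \<Longrightarrow> 2 * p - b - c \<le> int (word_dist (lamplighter_group m) (moves m) (f, b) (g, c))"
proof -
  let ?G = "lamplighter_group m"
  interpret group ?G by simp
  obtain h e where he: "inv\<^bsub>?G\<^esub> (f, b) \<otimes>\<^bsub>?G\<^esub> (g, c) = (h, e)"
    by fastforce
  have closed: "(h, e) \<in> carrier ?G"
    using m_closed[OF inv_closed[OF assms(2)] assms(3)] he by simp
  have "(f, b) \<otimes>\<^bsub>?G\<^esub> (h, e) = (g, c)"
    using assms(2,3) by (simp add: he[symmetric] m_assoc[symmetric])
  then have g: "g = (\<lambda>p. (f p + h (p - b)) mod int m)" and c: "c = b + e"
    by (auto simp: mult_lamplighter[OF assms(1)])
  obtain L R where LR: "L \<le> 0" "0 \<le> R" "L \<le> e" "e \<le> R" "{p. h p \<noteq> 0} \<subseteq> {L..<R}"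
    "2 * (R - L) - \<bar>e\<bar> \<le> int (word_dist ?G (moves m) (f, b) (g, c))"
    using word_length_extent[OF assms(1) closed] he by (metis word_dist_def)
  show "\<bar>c - b\<bar> \<le> int (word_dist ?G (moves m) (f, b) (g, c))"
  proof -
    have "\<bar>c - b\<bar> \<le> 2 * (R - L) - \<bar>e\<bar>"
      using LR(1-4) by (simp add: c abs_if)
    with LR(6) show ?thesis by linarith
  qed
  have p: "L \<le> p - b \<and> p - b < R" if "f p \<noteq> g p"
  proof -
    have "f p mod int m = f p"
      using assms(1,2) by (intro mod_pos_pos_trivial) (auto simp: carrier_lamplighter image_subset_iff)
    then have "h (p - b) \<noteq> 0"
      using that by (auto simp: g)
    with LR(5) show ?thesis by auto
  qed
  show "b + c - 2 * p \<le> int (word_dist ?G (moves m) (f, b) (g, c))" if "f p \<noteq> g p"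
  proof -
    \<comment> \<open>The left side is \<open>e - 2 * (p - b)\<close>, at most
      \<open>e - 2 * L\<close>; the rest follows from \<open>R\<close> bounding both 0 and
      \<open>e\<close>.\<close>
    have "b + c - 2 * p \<le> 2 * (R - L) - \<bar>e\<bar>"
      using LR(1-4) p[OF that] by (simp add: c abs_if)
    with LR(6) show ?thesis by linarith
  qed
  show "2 * p - b - c \<le> int (word_dist ?G (moves m) (f, b) (g, c))" if "f p \<noteq> g p"
  proof -
    have "2 * p - b - c \<le> 2 * (R - L) - \<bar>e\<bar>"
      using LR(1-4) p[OF that] by (simp add: c abs_if)
    with LR(6) show ?thesis by linarith
  qed
qed


section \<open>Counting lamp configurations\<close>

text \<open>The background \<open>h\<close> is arbitrary rather than zero so that lamps can also be
  frozen to the pattern of another point.\<close>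

lemma card_configurations:
  assumes "range h \<subseteq> {0..<int m}" "finite D"
  shows "finite {f. range f \<subseteq> {0..<int m} \<and> (\<forall>p. p \<notin> D \<longrightarrow> f p = h p)}" (is "finite ?X")
    and "card {f. range f \<subseteq> {0..<int m} \<and> (\<forall>p. p \<notin> D \<longrightarrow> f p = h p)} = m ^ card D"
proof -
  have bij: "bij_betw (\<lambda>f. restrict f D) ?X (PiE D (\<lambda>_. {0..<int m}))"
    using assms(1)
    by (intro bij_betw_byWitness[where f' = "\<lambda>g p. if p \<in> D then g p else h p"])
      (auto simp: fun_eq_iff PiE_iff extensional_def image_subset_iff)
  then show "finite ?X"
    using assms(2) by (simp add: bij_betw_finite finite_PiE)
  show "card ?X = m ^ card D"
    using bij_betw_same_card[OF bij] assms(2) by (simp add: card_PiE)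
qed

context
  fixes m :: nat
  assumes m: "m \<ge> 2"
begin

abbreviation sphere :: "nat \<Rightarrow> ((int \<Rightarrow> int) \<times> int) set"
  where "sphere n \<equiv> word_sphere (lamplighter_group m) (moves m) n"

abbreviation dist_moves :: "(int \<Rightarrow> int) \<times> int \<Rightarrow> (int \<Rightarrow> int) \<times> int \<Rightarrow> nat"
  where "dist_moves \<equiv> word_dist (lamplighter_group m) (moves m)"

lemma sphere_iff:
  "x \<in> sphere n \<longleftrightarrow>
    x \<in> carrier (lamplighter_group m) \<and> word_length (lamplighter_group m) (moves m) x = n"
  by (auto simp: word_sphere_def group.word_dist_one_left)

text \<open>A point of \<open>Y\<close> is determined by an interval \<open>{L..<R}\<close>, its
  cursor, and the lamps of the interval outside the prescribed set \<open>T\<close>: polynomially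
  many triples, each leaving at most \<open>N\<close> free lamps.\<close>

lemma card_sphere_subset_le:
  assumes Y: "Y \<subseteq> sphere n" and h: "range h \<subseteq> {0..<int m}"
    and agree: "\<And>f b p. (f, b) \<in> Y \<Longrightarrow> p \<in> T \<Longrightarrow> f p = h p"
    and extent: "\<And>f b L R. (f, b) \<in> Y \<Longrightarrow> L \<le> 0 \<Longrightarrow> 0 \<le> R \<Longrightarrow> L \<le> b \<Longrightarrow> b \<le> R \<Longrightarrow>
      2 * (R - L) - \<bar>b\<bar> \<le> int n \<Longrightarrow> card ({L..<R} - T) \<le> N"
  shows "finite Y" "card Y \<le> 2 * (n + 1) ^ 3 * m ^ N"
proof -
  \<comment> \<open>Since the modulus of \<open>b\<close> is at most \<open>R - L\<close>, the tour
    bound gives \<open>R - L\<close> \<le> \<open>n\<close>, which confines all three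
    parameters.\<close>
  define I where "I = {(L :: int, R :: int, b :: int). (L, R, b) \<in> {- int n..0} \<times> {0..int n} \<times> {- int n..int n} \<and>
    card ({L..<R} - T) \<le> N}"
  define h' where "h' p = (if p \<in> T then h p else 0)" for p
  define F where "F = (\<lambda>(L, R, b). (\<lambda>f. (f, b :: int)) `
    {f. range f \<subseteq> {0..<int m} \<and> (\<forall>p. p \<notin> {L..<R} - T \<longrightarrow> f p = h' p)})"
  have h': "range h' \<subseteq> {0..<int m}"
    using h m by (auto simp: h'_def image_subset_iff)
  have sub: "I \<subseteq> {- int n..0} \<times> {0..int n} \<times> {- int n..int n}"
    by (auto simp: I_def)
  have "finite I" "card I \<le> card ({- int n..0} \<times> {0..int n} \<times> {- int n..int n})"
    by (rule finite_subset[OF sub], simp) (rule card_mono[OF _ sub], simp)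
  then have I: "finite I" "card I \<le> (n + 1) * ((n + 1) * (2 * n + 1))"
    by (simp_all add: card_cartesian_product nat_add_distrib nat_mult_distrib)
  have F: "finite (F i)" "card (F i) \<le> m ^ N" if mem: "i \<in> I" for i
  proof -
    obtain L R b where i: "i = (L, R, b)" "card ({L..<R} - T) \<le> N"
      using mem by (auto simp: I_def)
    note c = card_configurations[OF h', of "{L..<R} - T"]
    show "finite (F i)"
      using c(1) by (simp add: F_def i)
    have "card (F i) \<le> m ^ card ({L..<R} - T)"
      using c card_image_le by (fastforce simp: F_def i)
    also have "\<dots> \<le> m ^ N"
      using m i(2) by (intro power_increasing) auto
    finally show "card (F i) \<le> m ^ N" .
  qed
  have Y_sub: "Y \<subseteq> (\<Union>i\<in>I. F i)"
  proof
    fix x assume x: "x \<in> Y"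
    obtain f b where fb: "x = (f, b)" by fastforce
    have closed: "(f, b) \<in> carrier (lamplighter_group m)"
      and len: "word_length (lamplighter_group m) (moves m) (f, b) = n"
      using x fb Y by (auto simp: sphere_iff)
    have m0: "m > 0" using m by simp
    obtain L R where LR: "L \<le> 0" "0 \<le> R" "L \<le> b" "b \<le> R" "{p. f p \<noteq> 0} \<subseteq> {L..<R}"
      "2 * (R - L) - \<bar>b\<bar> \<le> int n"
      using word_length_extent[OF m0 closed] len by metis
    have "f p = h' p" if "p \<notin> {L..<R} - T" for p
      using agree[of f b p] that x LR(5) by (auto simp: fb h'_def)
    moreover have "range f \<subseteq> {0..<int m}"
      using closed by (simp add: carrier_lamplighter[OF m0])
    ultimately have "x \<in> F (L, R, b)"
      by (auto simp: F_def fb)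
    moreover have "(L, R, b) \<in> I"
      using extent[of f b L R] x LR by (auto simp: I_def fb)
    ultimately show "x \<in> (\<Union>i\<in>I. F i)" by blast
  qed
  have fin: "finite (\<Union>i\<in>I. F i)"
    using I F by blast
  with Y_sub show "finite Y"
    by (rule finite_subset)
  have "card Y \<le> card (\<Union>i\<in>I. F i)"
    using fin Y_sub by (rule card_mono)
  also have "\<dots> \<le> (\<Sum>i\<in>I. card (F i))"
    using I(1) by (rule card_UN_le)
  also have "\<dots> \<le> (\<Sum>i\<in>I. m ^ N)"
    using F by (intro sum_mono) auto
  also have "\<dots> \<le> (n + 1) * ((n + 1) * (2 * n + 1)) * m ^ N"
    unfolding sum_constant by (simp only: of_nat_id mult_right_mono[OF I(2)])
  also have "\<dots> \<le> 2 * (n + 1) ^ 3 * m ^ N"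
    by (intro mult_right_mono) (auto simp: power3_eq_cube algebra_simps)
  finally show "card Y \<le> 2 * (n + 1) ^ 3 * m ^ N" .
qed

lemma finite_sphere: "finite (sphere n)"
proof (rule card_sphere_subset_le(1)[of _ n "\<lambda>_. 0" "{}" n])
  fix b L R :: int
  assume "L \<le> 0" "0 \<le> R" "L \<le> b" "b \<le> R" "2 * (R - L) - \<bar>b\<bar> \<le> int n"
  then show "card ({L..<R} - {}) \<le> n" by auto
qed (use m in auto)

text \<open>All patterns on \<open>{0..<int n}\<close> with cursor at \<open>n\<close> have length
  exactly \<open>n\<close>.\<close>

lemma card_sphere_ge: "m ^ n \<le> card (sphere n)"
proof -
  let ?F = "{f. range f \<subseteq> {0..<int m} \<and> (\<forall>p. p \<notin> {0..<int n} \<longrightarrow> f p = 0)}"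
  have m0: "m > 0" using m by simp
  have "(f, int n) \<in> sphere n" if "f \<in> ?F" for f
  proof -
    have supp: "{p. f p \<noteq> 0} \<subseteq> {0..<int n}"
      using that by blast
    then have "finite {p. f p \<noteq> 0}"
      by (rule finite_subset) simp
    with that supp show ?thesis
      by (simp add: sphere_iff carrier_lamplighter[OF m0] word_length_rightward[OF m0])
  qed
  then have "(\<lambda>f. (f, int n)) ` ?F \<subseteq> sphere n"
    by blast
  then have "card ((\<lambda>f. (f, int n)) ` ?F) \<le> card (sphere n)"
    by (intro card_mono finite_sphere)
  moreover have "card ((\<lambda>f. (f, int n)) ` ?F) = card ?F"
    by (intro card_image) (auto simp: inj_on_def)
  moreover have "card ?F = m ^ n"
    using card_configurations(2)[of "\<lambda>_. 0" m "{0..<int n}"] m0 by simp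
  ultimately show ?thesis by simp
qed

section \<open>Typical pairs of points on a sphere\<close>

definition near :: "nat \<Rightarrow> nat \<Rightarrow> ((int \<Rightarrow> int) \<times> int) set"
  where "near n k = {(f, b) \<in> sphere n. \<bar>b\<bar> \<le> int n - 2 * int k}"

text \<open>The exceptional second points for a first point with pattern \<open>g\<close>. The
  window of \<open>k\<close> lamps lies on the side of the cursor, where every tour has to cover
  it.\<close>

definition agreeing :: "nat \<Rightarrow> nat \<Rightarrow> (int \<Rightarrow> int) \<Rightarrow> ((int \<Rightarrow> int) \<times> int) set"
  where "agreeing n k g =
    {(f, b) \<in> sphere n. b \<ge> int k \<and> (\<forall>p\<in>{0..<int k}. f p = g p)} \<union>
    {(f, b) \<in> sphere n. b \<le> - int k \<and> (\<forall>p\<in>{- int k..<0}. f p = g p)}"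

text \<open>The tour bound gives \<open>2 * (R - L)\<close> \<le> \<open>n\<close> plus the modulus
  of \<open>b\<close>, here at most \<open>2 * n - 2 * k\<close>, so at most \<open>n - k\<close>
  lamps are free.\<close>

lemma card_near_le: "card (near n k) \<le> 2 * (n + 1) ^ 3 * m ^ (n - k)"
proof (rule card_sphere_subset_le(2)[of _ n "\<lambda>_. 0" "{}"])
  fix f b and L R :: int
  assume "(f, b) \<in> near n k" "2 * (R - L) - \<bar>b\<bar> \<le> int n"
  then show "card ({L..<R} - {}) \<le> n - k" by (auto simp: near_def)
qed (use m in \<open>auto simp: near_def\<close>)

text \<open>The interval has at most \<open>n\<close> lamps and contains the window, whose
  \<open>k\<close> lamps are prescribed by \<open>g\<close>; the two sides are counted
  separately.\<close>

lemma card_agreeing_le: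
  assumes "range g \<subseteq> {0..<int m}"
  shows "card (agreeing n k g) \<le> 4 * (n + 1) ^ 3 * m ^ (n - k)"
proof -
  have "card {(f, b) \<in> sphere n. b \<ge> int k \<and> (\<forall>p\<in>{0..<int k}. f p = g p)}
      \<le> 2 * (n + 1) ^ 3 * m ^ (n - k)" (is "card ?A \<le> _")
  proof (rule card_sphere_subset_le(2)[of _ n g "{0..<int k}"])
    fix f b and L R :: int
    assume "(f, b) \<in> ?A" and LR: "L \<le> 0" "0 \<le> R" "L \<le> b" "b \<le> R" "2 * (R - L) - \<bar>b\<bar> \<le> int n"
    then have "{0..<int k} \<subseteq> {L..<R}" by auto
    then have "card ({L..<R} - {0..<int k}) = nat (R - L) - k"
      by (subst card_Diff_subset) auto
    with LR show "card ({L..<R} - {0..<int k}) \<le> n - k" by auto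
  qed (use assms in auto)
  moreover have "card {(f, b) \<in> sphere n. b \<le> - int k \<and> (\<forall>p\<in>{- int k..<0}. f p = g p)}
      \<le> 2 * (n + 1) ^ 3 * m ^ (n - k)" (is "card ?B \<le> _")
  proof (rule card_sphere_subset_le(2)[of _ n g "{- int k..<0}"])
    fix f b and L R :: int
    assume "(f, b) \<in> ?B" and LR: "L \<le> 0" "0 \<le> R" "L \<le> b" "b \<le> R" "2 * (R - L) - \<bar>b\<bar> \<le> int n"
    then have "{- int k..<0} \<subseteq> {L..<R}" by auto
    then have "card ({L..<R} - {- int k..<0}) = nat (R - L) - k"
      by (subst card_Diff_subset) auto
    with LR show "card ({L..<R} - {- int k..<0}) \<le> n - k" by auto
  qed (use assms in auto)
  ultimately show ?thesis
    unfolding agreeing_def using card_Un_le[of ?A ?B] by linarith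
qed

text \<open>On the same side a differing window lamp forces a detour towards the origin, costing at
  most \<open>2 * k\<close> beyond the cursor defect \<open>4 * k\<close>; on opposite sides the
  cursors alone are far enough apart.\<close>

lemma typical_dist_ge:
  assumes k: "3 * k \<le> n"
    and x: "(f, b) \<in> sphere n" "(f, b) \<notin> near n k"
    and y: "(g, c) \<in> sphere n" "(g, c) \<notin> near n k" "(g, c) \<notin> agreeing n k f"
  shows "2 * int n - 6 * int k \<le> int (dist_moves (f, b) (g, c))"
proof -
  have m0: "m > 0" using m by simp
  have closed: "(f, b) \<in> carrier (lamplighter_group m)" "(g, c) \<in> carrier (lamplighter_group m)"
    using x y by (auto simp: sphere_iff)
  note dist = word_dist_ge_cursor[OF m0 closed]
  have bc: "\<bar>b\<bar> > int n - 2 * int k" "\<bar>c\<bar> > int n - 2 * int k"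
    using x y by (auto simp: near_def)
  show ?thesis
  proof (cases "b \<ge> 0"; cases "c \<ge> 0")
    assume "b \<ge> 0" "c \<ge> 0"
    \<comment> \<open>Here \<open>3 * k\<close> \<le> \<open>n\<close> puts the cursor
      \<open>c\<close> beyond the window, so not lying in \<open>agreeing\<close> yields a differing
      lamp.\<close>
    with bc k have "b > int n - 2 * int k" "c > int n - 2 * int k" "c \<ge> int k" by linarith+
    moreover from this y obtain p where "0 \<le> p" "p < int k" "f p \<noteq> g p"
      by (auto simp: agreeing_def)
    ultimately show ?thesis
      using dist(2)[of p] by linarith
  next
    assume "\<not> b \<ge> 0" "\<not> c \<ge> 0"
    with bc k have "- b > int n - 2 * int k" "- c > int n - 2 * int k" "c \<le> - int k" by linarith+
    moreover from this y obtain p where "- int k \<le> p" "p < 0" "f p \<noteq> g p"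
      by (auto simp: agreeing_def)
    ultimately show ?thesis
      using dist(3)[of p] by linarith
  next
    assume "b \<ge> 0" "\<not> c \<ge> 0"
    with bc have "b - c \<ge> 2 * int n - 4 * int k" by linarith
    with dist(1) show ?thesis by linarith
  next
    assume "\<not> b \<ge> 0" "c \<ge> 0"
    with bc have "c - b \<ge> 2 * int n - 4 * int k" by linarith
    with dist(1) show ?thesis by linarith
  qed
qed

section \<open>Bounds on the mean distance and passage to the limit\<close>

lemma mean_sphere_dist_le:
  assumes "n > 0"
  shows "mean_sphere_dist (lamplighter_group m) (moves m) n \<le> 2"
proof -
  let ?S = "sphere n"
  have m0: "m > 0" using m by simp
  interpret group "lamplighter_group m" by simp
  have "0 < m ^ n" using m0 by simp
  then have S: "card ?S > 0"
    using card_sphere_ge[of n] by linarith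
  have "1 / real n * real (dist_moves x y) \<le> 2" if "x \<in> ?S" "y \<in> ?S" for x y
  proof -
    have "dist_moves x y \<le> 2 * n"
      using word_dist_le_sum[OF finite_generating_set_moves[OF m0], of x y] that
      by (auto simp: sphere_iff)
    then have "real (dist_moves x y) \<le> 2 * real n" by linarith
    with assms show ?thesis by (simp add: field_simps)
  qed
  then have "(\<Sum>(x, y)\<in>?S \<times> ?S. 1 / real n * real (dist_moves x y)) \<le> (\<Sum>(x, y)\<in>?S \<times> ?S. 2)"
    by (intro sum_mono) auto
  also have "\<dots> = 2 * (real (card ?S))\<^sup>2"
    by (simp add: power2_eq_square card_cartesian_product case_prod_beta)
  finally show ?thesis
    using S by (simp add: mean_sphere_dist_def field_simps)
qed

text \<open>Typical pairs contribute at least \<open>2 - 6 * k / n\<close> each, and the other pairs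
  form a fraction of at most \<open>8 * (n + 1) ^ 3 / 2 ^ k\<close>, whose loss is at most
  doubled.\<close>

lemma mean_sphere_dist_ge:
  assumes n: "n > 0" and k: "3 * k \<le> n"
  shows "2 - 16 * (real n + 1) ^ 3 / 2 ^ k - 6 * real k / real n
    \<le> mean_sphere_dist (lamplighter_group m) (moves m) n"
proof -
  let ?S = "sphere n"
  \<comment> \<open>\<open>near\<close> has at most \<open>B\<close> points and
    \<open>agreeing\<close> at most \<open>2 * B\<close>, so each first point has at most
    \<open>3 * B\<close> bad partners; bad first points add another \<open>B\<close> times the
    sphere.\<close>
  define B where "B = 2 * (n + 1) ^ 3 * m ^ (n - k)"
  define bad where "bad = near n k \<times> ?S \<union> (SIGMA x : ?S. near n k \<union> agreeing n k (fst x))"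
  have m0: "m > 0" using m by simp
  have S: "card ?S > 0"
    using card_sphere_ge[of n] m0 by (meson less_le_trans zero_less_power)
  have sub: "near n k \<subseteq> ?S" "agreeing n k g \<subseteq> ?S" for g
    by (auto simp: near_def agreeing_def)
  then have fin: "finite (near n k)" "finite (agreeing n k g)" for g
    using finite_sphere finite_subset by blast+
  have "card (near n k \<union> agreeing n k (fst x)) \<le> 3 * B" if "x \<in> ?S" for x
  proof -
    have "range (fst x) \<subseteq> {0..<int m}"
      using that by (auto simp: sphere_iff carrier_lamplighter[OF m0])
    from card_agreeing_le[OF this, of n k] card_near_le[of n k] show ?thesis
      using card_Un_le[of "near n k" "agreeing n k (fst x)"] by (simp add: B_def)
  qed
  then have "(\<Sum>x\<in>?S. card (near n k \<union> agreeing n k (fst x))) \<le> (\<Sum>x\<in>?S. 3 * B)"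
    by (intro sum_mono)
  then have "card (SIGMA x : ?S. near n k \<union> agreeing n k (fst x)) \<le> 3 * B * card ?S"
    using finite_sphere fin by (simp add: card_SigmaI mult.commute)
  moreover have "card (near n k \<times> ?S) \<le> B * card ?S"
    using card_near_le[of n k] by (simp add: card_cartesian_product B_def)
  ultimately have bad: "card bad \<le> 4 * B * card ?S"
    unfolding bad_def
    using card_Un_le[of "near n k \<times> ?S" "SIGMA x : ?S. near n k \<union> agreeing n k (fst x)"]
    by linarith
  have bad_sub: "bad \<subseteq> ?S \<times> ?S"
    using sub by (auto simp: bad_def)
  have finSS: "finite (?S \<times> ?S)"
    using finite_sphere by simp
  define q where "q = 2 - 6 * real k / real n"
  have q: "0 \<le> q" "q \<le> 2"
    using n k by (auto simp: q_def field_simps)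
  have "q \<le> 1 / real n * real (dist_moves x y)" if "(x, y) \<in> ?S \<times> ?S - bad" for x y
  proof -
    obtain f b g c where xy: "x = (f, b)" "y = (g, c)"
      by fastforce
    have "2 * int n - 6 * int k \<le> int (dist_moves x y)"
      using that unfolding xy by (intro typical_dist_ge[OF k]) (auto simp: bad_def)
    then have "2 * real n - 6 * real k \<le> real (dist_moves x y)"
      by linarith
    then have "(2 * real n - 6 * real k) / real n \<le> real (dist_moves x y) / real n"
      by (intro divide_right_mono) auto
    with n show ?thesis by (simp add: q_def diff_divide_distrib)
  qed
  then have "(\<Sum>(x, y)\<in>?S \<times> ?S - bad. q)
      \<le> (\<Sum>(x, y)\<in>?S \<times> ?S - bad. 1 / real n * real (dist_moves x y))"
    by (intro sum_mono) auto
  \<comment> \<open>Bad pairs still contribute nonnegative distances.\<close>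
  also have "\<dots> \<le> (\<Sum>(x, y)\<in>?S \<times> ?S. 1 / real n * real (dist_moves x y))"
    using finSS by (intro sum_mono2) auto
  finally have "real (card (?S \<times> ?S - bad)) * q
      \<le> (\<Sum>(x, y)\<in>?S \<times> ?S. 1 / real n * real (dist_moves x y))"
    by (simp add: case_prod_beta)
  moreover have "real (card (?S \<times> ?S - bad)) = (real (card ?S))\<^sup>2 - real (card bad)"
    using card_Diff_subset[OF finite_subset[OF bad_sub finSS] bad_sub] card_mono[OF finSS bad_sub]
    by (simp add: card_cartesian_product power2_eq_square of_nat_diff)
  ultimately have "((real (card ?S))\<^sup>2 - real (card bad)) * q / (real (card ?S))\<^sup>2
      \<le> mean_sphere_dist (lamplighter_group m) (moves m) n"
    using S by (simp add: mean_sphere_dist_def divide_right_mono)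
  moreover have "((real (card ?S))\<^sup>2 - real (card bad)) * q / (real (card ?S))\<^sup>2
      = q - real (card bad) / (real (card ?S))\<^sup>2 * q"
    using S by (simp add: field_simps)
  moreover have "real (card bad) / (real (card ?S))\<^sup>2 \<le> 8 * (real n + 1) ^ 3 / 2 ^ k"
  proof -
    have "real (card bad) \<le> real (4 * B * card ?S)"
      using bad by (rule of_nat_mono)
    then have "real (card bad) / (real (card ?S))\<^sup>2 \<le> real (4 * B * card ?S) / (real (card ?S))\<^sup>2"
      by (intro divide_right_mono) auto
    also have "\<dots> = 4 * real B / real (card ?S)"
      using S by (simp add: power2_eq_square)
    also have "\<dots> \<le> 4 * real B / real (m ^ n)"
      using card_sphere_ge[of n] m0 S by (intro divide_left_mono mult_pos_pos) simp_all
    \<comment> \<open>As \<open>k\<close> \<le> \<open>n\<close>, the truncated exponent satisfies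
      \<open>m ^ n = m ^ (n - k) * m ^ k\<close>, and only \<open>m ^ k\<close> survives.\<close>
    also have "\<dots> = 8 * (real n + 1) ^ 3 / real m ^ k"
      using m0 k power_add[of "real m" "n - k" k] by (simp add: B_def field_simps)
    also have "\<dots> \<le> 8 * (real n + 1) ^ 3 / 2 ^ k"
      using m by (intro divide_left_mono power_mono) auto
    finally show ?thesis .
  qed
  then have "real (card bad) / (real (card ?S))\<^sup>2 * q \<le> 8 * (real n + 1) ^ 3 / 2 ^ k * 2"
    using q by (intro mult_mono) auto
  ultimately show ?thesis
    by (simp add: q_def)
qed

lemma mean_sphere_dist_tendsto:
  "mean_sphere_dist (lamplighter_group m) (moves m) \<longlonglongrightarrow> 2"
proof (rule tendsto_sandwich)
  \<comment> \<open>The choice \<open>k\<close> = floor of \<open>sqrt n\<close> makes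
    \<open>2 ^ k\<close> beat the cubic factor while \<open>k / n\<close> tends to 0. Bounding the
    floor by \<open>sqrt n - 1\<close> and \<open>sqrt n\<close> gives an expression free of
    rounding.\<close>
  let ?lower = "\<lambda>n. 2 - 16 * (real n + 1) ^ 3 / 2 powr (sqrt (real n) - 1) - 6 * sqrt (real n) / real n"
  show "?lower \<longlonglongrightarrow> 2"
    by real_asymp
  show "(\<lambda>_. 2 :: real) \<longlonglongrightarrow> 2"
    by simp
  show "\<forall>\<^sub>F n in sequentially. mean_sphere_dist (lamplighter_group m) (moves m) n \<le> 2"
    using eventually_gt_at_top[of 0] by eventually_elim (rule mean_sphere_dist_le)
  have "\<forall>\<^sub>F n in sequentially. 3 * sqrt (real n) \<le> real n"
    by real_asymp
  then show "\<forall>\<^sub>F n in sequentially. ?lower n \<le> mean_sphere_dist (lamplighter_group m) (moves m) n"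
    using eventually_gt_at_top[of 0]
  proof eventually_elim
    case (elim n)
    define k where "k = nat \<lfloor>sqrt (real n)\<rfloor>"
    have k: "real k \<le> sqrt (real n)" "sqrt (real n) - 1 \<le> real k"
      by (simp_all add: k_def)
    have "real (3 * k) \<le> real n"
      using k(1) elim(1) by simp
    then have "3 * k \<le> n"
      by (simp only: of_nat_le_iff)
    note ge = mean_sphere_dist_ge[OF elim(2) this]
    have "2 powr (sqrt (real n) - 1) \<le> 2 powr real k"
      using k(2) by (intro powr_mono) auto
    then have "2 powr (sqrt (real n) - 1) \<le> 2 ^ k"
      by (simp add: powr_realpow)
    then have "16 * (real n + 1) ^ 3 / 2 ^ k \<le> 16 * (real n + 1) ^ 3 / 2 powr (sqrt (real n) - 1)"
      by (intro divide_left_mono) auto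
    moreover have "6 * real k / real n \<le> 6 * sqrt (real n) / real n"
      using k(1) by (intro divide_right_mono) auto
    ultimately have "?lower n \<le> 2 - 16 * (real n + 1) ^ 3 / 2 ^ k - 6 * real k / real n"
      by (intro diff_mono order_refl)
    with ge show ?case by (rule order_trans[rotated])
  qed
qed

end

theorem corollary9:
  fixes m :: nat
  assumes "m \<ge> 2"
  shows "\<exists>S. finite_generating_set (lamplighter_group m) S \<and>
             statistically_hyperbolic (lamplighter_group m) S"
proof (intro exI conjI)
  show "finite_generating_set (lamplighter_group m) (moves m)"
    using assms by (intro finite_generating_set_moves) simp
  show "statistically_hyperbolic (lamplighter_group m) (moves m)"
    using mean_sphere_dist_tendsto[OF assms]
    unfolding statistically_hyperbolic_def sprawl_def by (metis convergentI limI)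
qed

end
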